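(* Let $V=[n]$, $k\ge1$, $\varepsilon\in(0,1)$, positive integers $B_1,\dots,B_k$ with $\sum_iB_i\le n$, and let $F:(k+1)^V\to\mathbb{R}_{\ge0}$ be $\varepsilon$-approximately diminishing returns. Let $\mathbf{x}$ be the output of $k$-Greedy-IS applied to $F$ and $B_1,\dots,B_k$. Then $F(\mathbf{x})\ge\frac{1-\varepsilon}{3+\varepsilon}\max\{F(\mathbf{y}):\mathbf{y}\in(k+1)^V,\ |\mathrm{supp}_i(\mathbf{y})|\le B_i\ \forall i\in[k]\}$.
   Context: $(k+1)^V$ is the set of $k$-tuples $\mathbf{x}=(X_1,\dots,X_k)$ of pairwise disjoint subsets of $V$ (identified with $\mathbf{x}\in\{0,\dots,k\}^V$, $\mathbf{x}(e)=i\iff e\in X_i$); $\mathbf{0}$ is the all-empty tuple; $\mathrm{supp}(\mathbf{x})=\bigcup_iX_i$, $\mathrm{supp}_i(\mathbf{x})=X_i$; $\mathbf{x}\preceq\mathbf{y}$ iff $X_i\subseteq Y_i$ $\forall i$; $\Delta_{u,i}g(\mathbf{x})=g(X_1,\dots,X_i\cup\{u\},\dots,X_k)-g(\mathbf{x})$ for $u\notin\mathrm{supp}(\mathbf{x})$. $f$ is $k$-submodular if $\Delta_{u,i}f(\mathbf{x})\ge\Delta_{u,i}f(\mathbf{y})$ for $\mathbf{x}\preceq\mathbf{y}$, $u\notin\mathrm{supp}(\mathbf{y})$, and $\Delta_{u,i}f(\mathbf{x})+\Delta_{u,j}f(\mathbf{x})\ge0$ for $i\ne j$; monotone if $\mathbf{x}\preceq\mathbf{y}\Rightarrow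 f(\mathbf{x})\le f(\mathbf{y})$. $F$ is $\varepsilon$-approximately diminishing returns if there is a monotone $k$-submodular $f$ with $f(\mathbf{0})=0$ and $(1-\varepsilon)\Delta_{u,i}f(\mathbf{x})\le\Delta_{u,i}F(\mathbf{x})\le(1+\varepsilon)\Delta_{u,i}f(\mathbf{x})$ for all $\mathbf{x}$, $u\notin\mathrm{supp}(\mathbf{x})$, $i$; $F(\mathbf{0})=0$. $k$-Greedy-IS: start with $\mathbf{x}=\mathbf{0}$, $I=[k]$; while $I\ne\emptyset$: pick $(e,i)\in\arg\max_{e\in V\setminus\mathrm{supp}(\mathbf{x}),\,i\in I}\Delta_{e,i}F(\mathbf{x})$ (ties arbitrary), set $\mathbf{x}(e)=i$, and if $|\mathrm{supp}_i(\mathbf{x})|=B_i$ remove $i$ from $I$; output $\mathbf{x}$. *)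

theory Defs
  imports Complex_Main "HOL-Library.FuncSet"
begin

text \<open>
  A tuple \<open>(X\<^sub>1, \<dots>, X\<^sub>k)\<close> of pairwise disjoint subsets of \<open>V\<close> is represented by its labelling
  \<open>x : V \<rightarrow> {0, \<dots>, k}\<close>, where \<open>x e = i\<close> iff \<open>e \<in> X\<^sub>i\<close> for \<open>i \<in> {1, \<dots>, k}\<close>, and \<open>x e = 0\<close> iff \<open>e\<close>
  lies in none of the sets.
\<close>

definition ktuples :: "'a set \<Rightarrow> nat \<Rightarrow> ('a \<Rightarrow> nat) set" where
  "ktuples V k = V \<rightarrow>\<^sub>E {0..k}"

definition zero_tuple :: "'a set \<Rightarrow> 'a \<Rightarrow> nat" where
  "zero_tuple V = (\<lambda>e\<in>V. 0)"

text \<open>The set \<open>X\<^sub>i\<close>; only meaningful for labels \<open>i \<ge> 1\<close>.\<close>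

definition supp_at :: "'a set \<Rightarrow> nat \<Rightarrow> ('a \<Rightarrow> nat) \<Rightarrow> 'a set" where
  "supp_at V i x = {e \<in> V. x e = i}"

definition supp :: "'a set \<Rightarrow> nat \<Rightarrow> ('a \<Rightarrow> nat) \<Rightarrow> 'a set" where
  "supp V k x = (\<Union>i\<in>{1..k}. supp_at V i x)"

definition tuple_le :: "'a set \<Rightarrow> nat \<Rightarrow> ('a \<Rightarrow> nat) \<Rightarrow> ('a \<Rightarrow> nat) \<Rightarrow> bool" where
  "tuple_le V k x y \<longleftrightarrow> (\<forall>i\<in>{1..k}. supp_at V i x \<subseteq> supp_at V i y)"

text \<open>
  For \<open>u \<in> V\<close> outside the support of \<open>x\<close>, relabelling \<open>u\<close> with \<open>i\<close> replaces \<open>X\<^sub>i\<close> by \<open>X\<^sub>i \<union> {u}\<close>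
  and leaves the other sets unchanged.
\<close>

definition marginal :: "(('a \<Rightarrow> nat) \<Rightarrow> real) \<Rightarrow> 'a \<Rightarrow> nat \<Rightarrow> ('a \<Rightarrow> nat) \<Rightarrow> real" where
  "marginal g u i x = g (x(u := i)) - g x"

definition k_submodular :: "'a set \<Rightarrow> nat \<Rightarrow> (('a \<Rightarrow> nat) \<Rightarrow> real) \<Rightarrow> bool" where
  "k_submodular V k f \<longleftrightarrow>
     (\<forall>x\<in>ktuples V k. \<forall>y\<in>ktuples V k. \<forall>u\<in>V - supp V k y. \<forall>i\<in>{1..k}.
        tuple_le V k x y \<longrightarrow> marginal f u i x \<ge> marginal f u i y) \<and>
     (\<forall>x\<in>ktuples V k. \<forall>u\<in>V - supp V k x. \<forall>i\<in>{1..k}. \<forall>j\<in>{1..k}.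
        i \<noteq> j \<longrightarrow> marginal f u i x + marginal f u j x \<ge> 0)"

definition tuple_monotone :: "'a set \<Rightarrow> nat \<Rightarrow> (('a \<Rightarrow> nat) \<Rightarrow> real) \<Rightarrow> bool" where
  "tuple_monotone V k f \<longleftrightarrow>
     (\<forall>x\<in>ktuples V k. \<forall>y\<in>ktuples V k. tuple_le V k x y \<longrightarrow> f x \<le> f y)"

definition approx_dim_returns ::
  "'a set \<Rightarrow> nat \<Rightarrow> real \<Rightarrow> (('a \<Rightarrow> nat) \<Rightarrow> real) \<Rightarrow> bool" where
  "approx_dim_returns V k \<epsilon> F \<longleftrightarrow>
     F (zero_tuple V) = 0 \<and>
     (\<exists>f. tuple_monotone V k f \<and> k_submodular V k f \<and> f (zero_tuple V) = 0 \<and>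
        (\<forall>x\<in>ktuples V k. \<forall>u\<in>V - supp V k x. \<forall>i\<in>{1..k}.
           (1 - \<epsilon>) * marginal f u i x \<le> marginal F u i x \<and>
           marginal F u i x \<le> (1 + \<epsilon>) * marginal f u i x))"

text \<open>
  Since ties are broken arbitrarily, the algorithm is modelled as a relation: a pair \<open>(x, I)\<close> is
  reachable if some sequence of tie-breaking choices leads to it at the head of the loop, and the
  possible outputs are the tuples reachable with \<open>I = {}\<close>.
\<close>

inductive greedy_is_reach ::
  "'a set \<Rightarrow> nat \<Rightarrow> (nat \<Rightarrow> nat) \<Rightarrow> (('a \<Rightarrow> nat) \<Rightarrow> real) \<Rightarrow> ('a \<Rightarrow> nat) \<Rightarrow> nat set \<Rightarrow> bool"
  for V k B F where
  init: "greedy_is_reach V k B F (zero_tuple V) {1..k}"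
| step: "\<lbrakk>greedy_is_reach V k B F x I; I \<noteq> {};
     is_arg_max (\<lambda>(e, i). marginal F e i x) (\<lambda>(e, i). e \<in> V - supp V k x \<and> i \<in> I) (e, i);
     x' = x(e := i);
     I' = (if card (supp_at V i x') = B i then I - {i} else I)\<rbrakk>
   \<Longrightarrow> greedy_is_reach V k B F x' I'"

definition greedy_is_output ::
  "'a set \<Rightarrow> nat \<Rightarrow> (nat \<Rightarrow> nat) \<Rightarrow> (('a \<Rightarrow> nat) \<Rightarrow> real) \<Rightarrow> ('a \<Rightarrow> nat) \<Rightarrow> bool" where
  "greedy_is_output V k B F x \<longleftrightarrow> greedy_is_reach V k B F x {}"

end

theory Submission imports Defs begin

text \<open>
  Fix a feasible \<open>p\<close>. Along the run of the algorithm it is transformed step by step, staying feasible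
  and above the current tuple: when \<open>e\<close> receives label \<open>i\<close>, first \<open>e\<close> is removed from \<open>p\<close>, then, if the
  budget of \<open>i\<close> is exhausted in \<open>p\<close>, some element of \<open>p\<close> with label \<open>i\<close> that is not yet chosen, and
  finally \<open>e\<close> is added with label \<open>i\<close>. Each of the at most two removals costs at most
  \<open>c = (1 + \<epsilon>) / (1 - \<epsilon>)\<close> times the gain of the step, because the removed pair was available to the
  algorithm. At the end all budgets are exhausted, so \<open>p\<close> has become the output \<open>x\<close>; hence
  \<open>F p - F x \<le> 2 * c * F x\<close>, and \<open>1 + 2 * c = (3 + \<epsilon>) / (1 - \<epsilon>)\<close>.
\<close>

lemma mem_supp_iff:
  assumes "x \<in> ktuples V k"
  shows "e \<in> supp V k x \<longleftrightarrow> e \<in> V \<and> x e \<noteq> 0"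
proof -
  have "x e \<le> k" if "e \<in> V"
    using assms that by (auto simp: ktuples_def)
  then show ?thesis
    by (auto simp: supp_def supp_at_def Suc_le_eq)
qed

lemma tuple_le_iff:
  assumes "x \<in> ktuples V k"
  shows "tuple_le V k x y \<longleftrightarrow> (\<forall>e\<in>V. x e \<noteq> 0 \<longrightarrow> y e = x e)"
proof -
  have "x e \<le> k" if "e \<in> V" for e
    using assms that by (auto simp: ktuples_def)
  then show ?thesis
    by (fastforce simp: tuple_le_def supp_at_def Suc_le_eq)
qed

lemma ktuples_upd:
  assumes "x \<in> ktuples V k" "u \<in> V" "i \<le> k"
  shows "x(u := i) \<in> ktuples V k"
  using assms by (auto simp: ktuples_def PiE_def extensional_def)

lemma finite_ktuples: "finite V \<Longrightarrow> finite (ktuples V k)"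
  by (simp add: ktuples_def finite_PiE)

lemma zero_tuple_in: "zero_tuple V \<in> ktuples V k"
  by (auto simp: ktuples_def zero_tuple_def)

lemma supp_at_upd:
  "u \<in> V \<Longrightarrow> supp_at V j (x(u := i)) =
     (if j = i then insert u (supp_at V j x) else supp_at V j x - {u})"
  by (auto simp: supp_at_def)

lemma supp_at_upd_unlabelled:
  "x u = 0 \<Longrightarrow> u \<in> V \<Longrightarrow> j \<noteq> 0 \<Longrightarrow> supp_at V j (x(u := i)) =
     (if j = i then insert u (supp_at V j x) else supp_at V j x)"
  by (auto simp: supp_at_def)

text \<open>Here the comparison function of \<open>approx_dim_returns\<close> is replaced by a
  single constant: along \<open>tuple_le\<close>, a gain of \<open>F\<close> may grow by a factor of
  at most \<open>c\<close>.\<close>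

locale weak_diminishing_returns =
  fixes V :: "'a set" and k :: nat and B :: "nat \<Rightarrow> nat" and F :: "('a \<Rightarrow> nat) \<Rightarrow> real"
    and c :: real
  assumes finite_V: "finite V"
    and F_zero: "F (zero_tuple V) = 0"
    and c_nonneg: "0 \<le> c"
    and gain_nonneg:
      "\<lbrakk>x \<in> ktuples V k; u \<in> V; x u = 0; i \<in> {1..k}\<rbrakk> \<Longrightarrow> 0 \<le> marginal F u i x"
    and gain_le:
      "\<lbrakk>x \<in> ktuples V k; y \<in> ktuples V k; tuple_le V k x y; u \<in> V; y u = 0; i \<in> {1..k}\<rbrakk>
       \<Longrightarrow> marginal F u i y \<le> c * marginal F u i x"
begin

definition feasible :: "('a \<Rightarrow> nat) set" where
  "feasible = {y \<in> ktuples V k. \<forall>i\<in>{1..k}. card (supp_at V i y) \<le> B i}"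

lemma finite_supp_at: "finite (supp_at V i x)"
  using finite_V by (simp add: supp_at_def)

lemma feasible_card: "p \<in> feasible \<Longrightarrow> i \<in> {1..k} \<Longrightarrow> card (supp_at V i p) \<le> B i"
  by (simp add: feasible_def)

lemma feasible_remove:
  assumes "p \<in> feasible" "u \<in> V"
  shows "p(u := 0) \<in> feasible"
proof -
  have "card (supp_at V i (p(u := 0))) \<le> card (supp_at V i p)" if "i \<in> {1..k}" for i
    using that finite_supp_at by (intro card_mono) (auto simp: supp_at_def)
  then show ?thesis
    using assms by (force simp: feasible_def intro: ktuples_upd)
qed

lemma tuple_le_remove:
  assumes "x \<in> ktuples V k" "tuple_le V k x p" "x u = 0"
  shows "tuple_le V k x (p(u := 0))"
  using assms by (auto simp: tuple_le_iff)

text \<open>Since \<open>x\<close> lies below \<open>p\<close> and \<open>u\<close> is labelled in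
  \<open>p\<close> only, the label of \<open>u\<close> in \<open>p\<close> occurs less often in
  \<open>x\<close> than in \<open>p\<close>, so its budget is not exhausted in \<open>x\<close>.
  Thus \<open>u\<close> with this label competes in the greedy choice, and its gain at
  \<open>x\<close> is at most \<open>d\<close>; \<open>gain_le\<close> carries this over to
  \<open>p\<close> without \<open>u\<close>.\<close>

lemma removal_loss:
  assumes x: "x \<in> ktuples V k" and p: "p \<in> feasible" and le: "tuple_le V k x p"
    and u: "u \<in> V" "x u = 0"
    and best: "\<And>v i. \<lbrakk>v \<in> V; x v = 0; i \<in> {1..k}; card (supp_at V i x) < B i\<rbrakk>
                 \<Longrightarrow> marginal F v i x \<le> d"
    and d: "0 \<le> d"
  shows "F p - F (p(u := 0)) \<le> c * d"
proof (cases "p u = 0")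
  case True
  then have "p(u := 0) = p" by auto
  then show ?thesis using c_nonneg d by simp
next
  case False
  define i where "i = p u"
  have pk: "p \<in> ktuples V k" using p by (simp add: feasible_def)
  have i: "i \<in> {1..k}"
    using pk u False by (auto simp: ktuples_def i_def Suc_le_eq)
  have "supp_at V i x \<subseteq> supp_at V i p" using le i by (simp add: tuple_le_def)
  moreover have "u \<in> supp_at V i p" "u \<notin> supp_at V i x"
    using u False by (simp_all add: supp_at_def i_def)
  ultimately have "supp_at V i x \<subset> supp_at V i p" by blast
  then have "card (supp_at V i x) < B i"
    by (rule less_le_trans[OF psubset_card_mono[OF finite_supp_at] feasible_card[OF p i]])
  then have *: "marginal F u i x \<le> d" using best u i by blast
  have "F p - F (p(u := 0)) = marginal F u i (p(u := 0))"
    by (simp add: marginal_def i_def)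
  also have "\<dots> \<le> c * marginal F u i x"
    using x pk u i le by (intro gain_le tuple_le_remove ktuples_upd) auto
  also have "\<dots> \<le> c * d" using * c_nonneg by (rule mult_left_mono)
  finally show ?thesis .
qed

text \<open>The factor \<open>2\<close> counts the removals; putting \<open>e\<close> back with
  label \<open>i\<close> costs nothing by \<open>gain_nonneg\<close>.\<close>

lemma exchange:
  assumes x: "x \<in> ktuples V k" and p: "p \<in> feasible" and le: "tuple_le V k x p"
    and e: "e \<in> V" "x e = 0" and i: "i \<in> {1..k}" "card (supp_at V i x) < B i"
    and best: "\<And>v j. \<lbrakk>v \<in> V; x v = 0; j \<in> {1..k}; card (supp_at V j x) < B j\<rbrakk>
                 \<Longrightarrow> marginal F v j x \<le> marginal F e i x"
  shows "\<exists>q\<in>feasible. tuple_le V k (x(e := i)) q \<and> F p - F q \<le> 2 * c * marginal F e i x"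
proof -
  define d where "d = marginal F e i x"
  have d: "0 \<le> d" unfolding d_def using x e i by (intro gain_nonneg)
  \<comment> \<open>Both removals are measured against the same \<open>x\<close> and the same
    \<open>d\<close>; only the tuple that loses an element varies.\<close>
  note loss = removal_loss[OF x _ _ _ _ best, folded d_def, OF _ _ _ _ _ _ _ _ d]
  \<comment> \<open>The last move, shared by both cases: \<open>r\<close> is what remains of
    \<open>p\<close> after one or two removals, with room for label \<open>i\<close>.\<close>
  have add: "\<exists>q\<in>feasible. tuple_le V k (x(e := i)) q \<and> F p - F q \<le> 2 * c * marginal F e i x"
    if r: "r \<in> feasible" "tuple_le V k x r" "r e = 0" "card (supp_at V i r) < B i"
      and Fr: "F p - F r \<le> 2 * c * d" for r
  proof (intro bexI conjI)
    have rk: "r \<in> ktuples V k" using r by (simp add: feasible_def)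
    show "r(e := i) \<in> feasible"
      using r rk e i
      by (auto simp: feasible_def supp_at_upd_unlabelled card_insert_if finite_supp_at
               intro: ktuples_upd)
    show "tuple_le V k (x(e := i)) (r(e := i))"
      using x r e i by (simp add: tuple_le_iff ktuples_upd)
    have "0 \<le> marginal F e i r" using rk e r i by (intro gain_nonneg)
    then show "F p - F (r(e := i)) \<le> 2 * c * marginal F e i x"
      using Fr by (simp add: marginal_def[of F e i r] d_def)
  qed
  let ?q = "p(e := 0)"
  have q: "?q \<in> feasible" "tuple_le V k x ?q" "F p - F ?q \<le> c * d"
    using feasible_remove[OF p e(1)] tuple_le_remove[OF x le e(2)]
      loss[OF p le e] by auto
  show ?thesis
  proof (cases "card (supp_at V i ?q) < B i")
    case True
    have "0 \<le> c * d" using c_nonneg d by simp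
    then show ?thesis using q True by (intro add[of ?q]) auto
  next
    case False
    \<comment> \<open>Label \<open>i\<close> occurs at least \<open>B i\<close> times in
      \<open>?q\<close> but fewer times in \<open>x\<close>, so some \<open>u\<close> carries it in
      \<open>?q\<close> only. As \<open>x\<close> lies below \<open>?q\<close>, such a
      \<open>u\<close> is unlabelled in \<open>x\<close>.\<close>
    then have "\<not> supp_at V i ?q \<subseteq> supp_at V i x"
      using card_mono[OF finite_supp_at, of "supp_at V i ?q" i x] i by linarith
    then obtain u where u: "u \<in> V" "?q u = i" "x u \<noteq> i" by (auto simp: supp_at_def)
    have xu: "x u = 0" using q(2) u x by (force simp: tuple_le_iff)
    let ?r = "?q(u := 0)"
    have "supp_at V i ?r = supp_at V i ?q - {u}" "u \<in> supp_at V i ?q"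
      using u i by (simp_all add: supp_at_upd) (simp add: supp_at_def)
    then have "supp_at V i ?r \<subset> supp_at V i ?q" by blast
    then have card: "card (supp_at V i ?r) < B i"
      by (rule less_le_trans[OF psubset_card_mono[OF finite_supp_at] feasible_card[OF q(1) i(1)]])
    have "F ?q - F ?r \<le> c * d" using loss[OF q(1,2) u(1) xu] by auto
    then show ?thesis
      using q card feasible_remove[OF q(1) u(1)] tuple_le_remove[OF x q(2) xu]
      by (intro add[of ?r]) auto
  qed
qed

text \<open>The losses of the single steps telescope to \<open>2 * c * F x\<close> because
  \<open>F\<close> vanishes at \<open>zero_tuple V\<close>. Identifying \<open>I\<close> with the
  labels below budget lets the greedy choice serve as the \<open>best\<close> premise of
  \<open>exchange\<close>; positive budgets make this true at the start.\<close>

lemma greedy_invariant: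
  assumes "greedy_is_reach V k B F x I" and B: "\<forall>i\<in>{1..k}. 0 < B i" and p: "p \<in> feasible"
  shows "x \<in> feasible \<and> I = {i \<in> {1..k}. card (supp_at V i x) < B i} \<and>
         (\<exists>q\<in>feasible. tuple_le V k x q \<and> F p - F q \<le> 2 * c * F x)"
  using assms(1)
proof induction
  case init
  have "supp_at V i (zero_tuple V) = {}" if "i \<in> {1..k}" for i
    using that by (auto simp: supp_at_def zero_tuple_def)
  moreover have "tuple_le V k (zero_tuple V) p"
    by (simp add: tuple_le_iff zero_tuple_in) (simp add: zero_tuple_def)
  ultimately show ?case
    using B p zero_tuple_in by (auto simp: feasible_def F_zero)
next
  case (step x I e i x' I')
  then obtain q where x: "x \<in> feasible" and I: "I = {i \<in> {1..k}. card (supp_at V i x) < B i}"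
    and q: "q \<in> feasible" "tuple_le V k x q" "F p - F q \<le> 2 * c * F x" by blast
  have xk: "x \<in> ktuples V k" using x by (simp add: feasible_def)
  have ei: "e \<in> V" "x e = 0" "i \<in> I"
    and best: "\<And>v j. \<lbrakk>v \<in> V; x v = 0; j \<in> I\<rbrakk> \<Longrightarrow> marginal F v j x \<le> marginal F e i x"
    using step.hyps(3) xk by (auto simp: is_arg_max_linorder mem_supp_iff)
  have i: "i \<in> {1..k}" "card (supp_at V i x) < B i" using ei I by auto
  obtain r where r: "r \<in> feasible" "tuple_le V k x' r" "F q - F r \<le> 2 * c * marginal F e i x"
    using exchange[OF xk q(1,2) ei(1,2) i] best I step.hyps(4) by auto
  have "F p - F r \<le> 2 * c * F x'"
    using q(3) r(3) step.hyps(4) by (simp add: marginal_def algebra_simps)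
  moreover have card: "card (supp_at V j x') = card (supp_at V j x) + (if j = i then 1 else 0)"
    if "j \<in> {1..k}" for j
    using that ei step.hyps(4) finite_supp_at
    by (auto simp: supp_at_upd_unlabelled card_insert_if) (auto simp: supp_at_def)
  moreover have "x' \<in> feasible"
    using x card i ei step.hyps(4) by (auto simp: feasible_def intro: ktuples_upd)
  \<comment> \<open>The count of label \<open>i\<close> rises by one from below \<open>B i\<close>,
    so it either stays below or hits \<open>B i\<close> exactly, which the equality test
    detects.\<close>
  moreover have "I' = {i \<in> {1..k}. card (supp_at V i x') < B i}"
    using step.hyps(5) I i card by (auto split: if_splits)
  ultimately show ?case using r by blast
qed

lemma greedy_bound:
  assumes "greedy_is_output V k B F x" and B: "\<forall>i\<in>{1..k}. 0 < B i" and p: "p \<in> feasible"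
  shows "F p \<le> (1 + 2 * c) * F x"
proof -
  obtain q where x: "x \<in> feasible" and full: "\<forall>i\<in>{1..k}. B i \<le> card (supp_at V i x)"
    and q: "q \<in> feasible" "tuple_le V k x q" "F p - F q \<le> 2 * c * F x"
    using greedy_invariant[OF assms(1)[unfolded greedy_is_output_def] B p]
    by (auto simp: not_less)
  have xk: "x \<in> ktuples V k" and qk: "q \<in> ktuples V k"
    using x q by (auto simp: feasible_def)
  \<comment> \<open>The inclusion from \<open>tuple_le\<close> is an equality, since
    \<open>x\<close> fills the budget that \<open>q\<close> respects.\<close>
  have eq: "supp_at V i x = supp_at V i q" if "i \<in> {1..k}" for i
    using that full q by (intro card_seteq finite_supp_at) (force simp: feasible_def tuple_le_def)+
  have "x e = q e" for e
  proof (cases "e \<in> V \<and> q e \<noteq> 0")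
    case True
    then have "q e \<in> {1..k}" using qk by (auto simp: ktuples_def Suc_le_eq)
    from eq[OF this] True show ?thesis by (auto simp: supp_at_def)
  \<comment> \<open>Inside \<open>V\<close>, \<open>q e = 0\<close> forces \<open>x e = 0\<close> by
    \<open>tuple_le\<close>; outside \<open>V\<close> both labellings are
    \<open>undefined\<close>.\<close>
  next
    case False
    then show ?thesis
      using q(2) xk qk by (cases "e \<in> V") (auto simp: tuple_le_iff ktuples_def PiE_def extensional_def)
  qed
  then have "x = q" by blast
  then show ?thesis using q(3) by (simp add: algebra_simps)
qed

end

text \<open>The gain of \<open>F\<close> at \<open>y\<close> is at most
  \<open>1 + \<epsilon>\<close> times that of \<open>f\<close> at \<open>y\<close>, hence at
  \<open>x\<close>, where the lower estimate returns to \<open>F\<close> at the price of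
  \<open>1 / (1 - \<epsilon>)\<close>. Gains of \<open>F\<close> are nonnegative because those of
  the monotone \<open>f\<close> are.\<close>

lemma approx_dim_returns_weak:
  assumes "finite V" "0 < \<epsilon>" "\<epsilon> < 1" and F: "approx_dim_returns V k \<epsilon> F"
  shows "weak_diminishing_returns V k F ((1 + \<epsilon>) / (1 - \<epsilon>))"
proof -
  obtain f where mono: "tuple_monotone V k f" and sub: "k_submodular V k f"
    and lo: "\<And>x u i. \<lbrakk>x \<in> ktuples V k; u \<in> V; x u = 0; i \<in> {1..k}\<rbrakk>
              \<Longrightarrow> (1 - \<epsilon>) * marginal f u i x \<le> marginal F u i x"
    and hi: "\<And>x u i. \<lbrakk>x \<in> ktuples V k; u \<in> V; x u = 0; i \<in> {1..k}\<rbrakk>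
              \<Longrightarrow> marginal F u i x \<le> (1 + \<epsilon>) * marginal f u i x"
    using F by (auto simp: approx_dim_returns_def mem_supp_iff)
  show ?thesis
  proof
    show "finite V" "F (zero_tuple V) = 0" "0 \<le> (1 + \<epsilon>) / (1 - \<epsilon>)"
      using assms by (auto simp: approx_dim_returns_def)
  next
    fix x u i assume x: "x \<in> ktuples V k" "u \<in> V" "x u = 0" "i \<in> {1..k}"
    have "tuple_le V k x (x(u := i))" using x by (auto simp: tuple_le_iff)
    then have "0 \<le> marginal f u i x"
      using mono x ktuples_upd[of x V k u i] by (auto simp: tuple_monotone_def marginal_def)
    then have "0 \<le> (1 - \<epsilon>) * marginal f u i x" using assms(3) by simp
    then show "0 \<le> marginal F u i x" using lo[OF x] by linarith
  next
    fix x y u i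
    assume x: "x \<in> ktuples V k" and y: "y \<in> ktuples V k" and le: "tuple_le V k x y"
      and u: "u \<in> V" "y u = 0" and i: "i \<in> {1..k}"
    have xu: "x u = 0" using le x u by (metis tuple_le_iff)
    have "marginal F u i y \<le> (1 + \<epsilon>) * marginal f u i y" using hi y u i by blast
    also have "marginal f u i y \<le> marginal f u i x"
      using sub x y le u i by (auto simp: k_submodular_def mem_supp_iff)
    also have "marginal f u i x \<le> marginal F u i x / (1 - \<epsilon>)"
      using lo[OF x u(1) xu i] assms(3) by (simp add: field_simps)
    finally show "marginal F u i y \<le> (1 + \<epsilon>) / (1 - \<epsilon>) * marginal F u i x"
      using assms(2) by simp
  qed
qed

theorem theorem7:
  fixes n k :: nat and \<epsilon> :: real and B :: "nat \<Rightarrow> nat"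
    and V :: "nat set" and F :: "(nat \<Rightarrow> nat) \<Rightarrow> real" and x :: "nat \<Rightarrow> nat"
  assumes "V = {1..n}"
    and "k \<ge> 1"
    and "0 < \<epsilon>" and "\<epsilon> < 1"
    and "\<forall>i\<in>{1..k}. 0 < B i"
    and "(\<Sum>i=1..k. B i) \<le> n"
    and "\<forall>y\<in>ktuples V k. 0 \<le> F y"
    and "approx_dim_returns V k \<epsilon> F"
    and "greedy_is_output V k B F x"
  shows "F x \<ge> (1 - \<epsilon>) / (3 + \<epsilon>) *
           Max (F ` {y \<in> ktuples V k. \<forall>i\<in>{1..k}. card (supp_at V i y) \<le> B i})"
proof -
  have fin: "finite V" using assms(1) by simp
  interpret weak_diminishing_returns V k B F "(1 + \<epsilon>) / (1 - \<epsilon>)"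
    using approx_dim_returns_weak[OF fin assms(3,4,8)] .
  have ratio: "1 + 2 * ((1 + \<epsilon>) / (1 - \<epsilon>)) = (3 + \<epsilon>) / (1 - \<epsilon>)"
    using assms(4) by (simp add: field_simps)
  have bound: "(1 - \<epsilon>) / (3 + \<epsilon>) * F y \<le> F x" if "y \<in> feasible" for y
    using greedy_bound[OF assms(9,5) that] assms(3,4)
    unfolding ratio by (simp add: field_simps)
  \<comment> \<open>Finiteness, together with the feasible \<open>zero_tuple V\<close>, ensures that
    the maximum is attained, so a bound for each feasible tuple suffices.\<close>
  have "finite feasible"
    using finite_ktuples[OF fin] by (simp add: feasible_def)
  moreover have "zero_tuple V \<in> feasible"
    using zero_tuple_in by (auto simp: feasible_def supp_at_def zero_tuple_def)
  ultimately have "Max (F ` feasible) \<in> F ` feasible"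
    by (intro Max_in) auto
  then show ?thesis using bound unfolding feasible_def by auto
qed

end
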